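(* Let $p>0$, $n\geq 4p$ and $\gamma>0$ be integers. Suppose there exists an integer $\alpha$ with $2p-1\leq \alpha\leq n-1-2p$ and $\gcd(n,\alpha)=1$. Then there exists a globally simple support shifted Heffter array $H(n;4p,\gamma)$ whose non-empty cells are precisely the cells of the diagonals $D_i$ for $i\in\{0,1,\dots,4p-2\}\cup\{2p+\alpha\}$.
   Context: Rows and columns of an $n\times n$ array are indexed by $0,1,\dots,n-1$, with indices computed modulo $n$. For $d\in\{0,\dots,n-1\}$ the diagonal $D_d$ is the set of cells $\{(i+d \bmod n,\ i) : i=0,\dots,n-1\}$, where $(r,c)$ denotes row $r$, column $c$. The support of an array is the set of absolute values of its entries. A support shifted Heffter array $H(n;4p,\gamma)$ is an $n\times n$ array $A$ of integers (some cells empty) such that: (P1) every row and every column of $A$ has exactly $4p$ filled cells; (P2) the support of $A$ is $\{\gamma n+1,\dots,(4p+\gamma)n\}$; (P3) the entries in every row and every column sum to $0$ (in $\mathbb{Z}$). It is globally simple if moreover, for every row (entries read from left to right, i.e. increasing column index) and every column (entries read from top to bottom, i.e. increasing row index), writing its entries in this order as $a_0,\dots,a_{4p-1}$, the partial sums $\sum_{j=0}^{i}a_j$, $i=0,\dots,4p-1$, are pairwise distinct modulo $2(4p+\gamma)n+1$. *)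

theory Defs
  imports Main
begin

text \<open>Only the cells \<open>(r, c)\<close> with \<open>r, c < n\<close> belong to an \<open>n \<times> n\<close> array; the values of the function
  outside this range are ignored by all notions below. \<open>None\<close> stands for an empty cell.\<close>

type_synonym heffter_array = "nat \<Rightarrow> nat \<Rightarrow> int option"

definition filled_cells :: "nat \<Rightarrow> heffter_array \<Rightarrow> (nat \<times> nat) set" where
  "filled_cells n A = {(r, c). r < n \<and> c < n \<and> A r c \<noteq> None}"

definition diagonal :: "nat \<Rightarrow> nat \<Rightarrow> (nat \<times> nat) set" where
  "diagonal n d = {((i + d) mod n, i) | i. i < n}"

definition array_support :: "nat \<Rightarrow> heffter_array \<Rightarrow> int set" where
  "array_support n A = {\<bar>x\<bar> | x r c. r < n \<and> c < n \<and> A r c = Some x}"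

text \<open>The filled entries of a row from left to right, and of a column from top to bottom.\<close>

definition row_entries :: "nat \<Rightarrow> heffter_array \<Rightarrow> nat \<Rightarrow> int list" where
  "row_entries n A r = List.map_filter (\<lambda>c. A r c) [0..<n]"

definition col_entries :: "nat \<Rightarrow> heffter_array \<Rightarrow> nat \<Rightarrow> int list" where
  "col_entries n A c = List.map_filter (\<lambda>r. A r c) [0..<n]"

definition support_shifted_heffter :: "nat \<Rightarrow> nat \<Rightarrow> nat \<Rightarrow> heffter_array \<Rightarrow> bool" where
  "support_shifted_heffter n k \<gamma> A \<longleftrightarrow>
     (\<forall>i<n. length (row_entries n A i) = k \<and> length (col_entries n A i) = k) \<and>
     array_support n A = {int (\<gamma> * n + 1)..int ((k + \<gamma>) * n)} \<and>
     (\<forall>i<n. sum_list (row_entries n A i) = 0 \<and> sum_list (col_entries n A i) = 0)"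

definition simple_modulo :: "int \<Rightarrow> int list \<Rightarrow> bool" where
  "simple_modulo m xs \<longleftrightarrow>
     distinct (map (\<lambda>i. (\<Sum>j\<le>i. xs ! j) mod m) [0..<length xs])"

definition globally_simple :: "nat \<Rightarrow> nat \<Rightarrow> nat \<Rightarrow> heffter_array \<Rightarrow> bool" where
  "globally_simple n k \<gamma> A \<longleftrightarrow>
     (\<forall>i<n. simple_modulo (int (2 * (k + \<gamma>) * n + 1)) (row_entries n A i) \<and>
            simple_modulo (int (2 * (k + \<gamma>) * n + 1)) (col_entries n A i))"

end

theory Submission
  imports Defs
begin

text \<open>The \<open>4 p\<close> diagonals are paired: \<open>D\<^sub>2\<^sub>j\<close> with the next one for \<open>j < p\<close>, then
  \<open>D\<^sub>2\<^sub>p\<close> with the isolated diagonal, then the remaining \<open>p - 1\<close> consecutive pairs. Each diagonal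
  uses up a block of \<open>n\<close> consecutive absolute values, the two diagonals of a pair having
  adjacent blocks and opposite signs, in such a way that a pair contributes \<open>-n\<close> (first \<open>p\<close>
  pairs) or \<open>n\<close> (last \<open>p\<close> pairs) to every column, and \<open>\<mp>(n + 1)\<close> to every row except for
  \<open>\<mp>1\<close> in row \<open>0\<close>. Hence all lines have sum zero. Since a line has sum zero, rotating or
  reversing it preserves simplicity, so the entries may be read in the order of
  the diagonals. The entry on \<open>D\<^sub>2\<^sub>p\<close> is compensated only at the very end of a line, so it shifts all
  partial sums of the second half; its block is chosen large enough to keep the two halves
  apart.\<close>

section \<open>Simplicity under rotation and reversal\<close>

lemma simple_modulo_iff_inj_on_take:
  "simple_modulo m xs \<longleftrightarrow> inj_on (\<lambda>k. sum_list (take k xs) mod m) {1..length xs}"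
proof -
  have part: "(\<Sum>j\<le>i. xs ! j) = sum_list (take (Suc i) xs)" if "i < length xs" for i
    using that by (simp add: sum_list_sum_nth atLeast0LessThan lessThan_Suc_atMost)
  have "simple_modulo m xs \<longleftrightarrow> inj_on (\<lambda>i. (\<Sum>j\<le>i. xs ! j) mod m) {..<length xs}"
    by (simp add: simple_modulo_def distinct_map atLeast0LessThan)
  also have "\<dots> \<longleftrightarrow> inj_on ((\<lambda>k. sum_list (take k xs) mod m) \<circ> Suc) {..<length xs}"
    by (intro inj_on_cong) (simp add: part)
  also have "\<dots> \<longleftrightarrow> inj_on (\<lambda>k. sum_list (take k xs) mod m) (Suc ` {..<length xs})"
    by (metis comp_inj_on_iff inj_Suc inj_on_subset subset_UNIV)
  also have "Suc ` {..<length xs} = {1..length xs}"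
    by (simp add: image_Suc_lessThan)
  finally show ?thesis .
qed

text \<open>With total zero the empty prefix and the whole list have the same sum, so one can stand
  in for the other. Switching between the two ranges of prefix lengths absorbs the index shifts
  caused by rotation and reversal.\<close>

lemma simple_modulo_iff_inj_on_take_lessThan:
  assumes "sum_list xs = 0"
  shows "simple_modulo m xs \<longleftrightarrow> inj_on (\<lambda>k. sum_list (take k xs) mod m) {..<length xs}"
proof -
  let ?s = "\<lambda>k. sum_list (take k xs) mod m"
  have ends: "?s (length xs) = ?s 0"
    using assms by simp
  have "inj_on ?s {1..length xs} \<longleftrightarrow> inj_on ?s {..<length xs}"
  proof (cases xs)
    case (Cons x ys)
    define N where "N = length ys"
    have up: "{1..length xs} = insert (length xs) {1..N}" "{..<length xs} = insert 0 {1..N}"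
      using Cons by (auto simp: N_def)
    have "length xs \<notin> {1..N}"
      using Cons by (simp add: N_def)
    then show ?thesis
      unfolding up inj_on_insert using ends by auto
  qed simp
  then show ?thesis
    by (simp add: simple_modulo_iff_inj_on_take)
qed

lemma mod_eq_shift_iff:
  fixes a b c m :: int
  shows "(a - c) mod m = (b - c) mod m \<longleftrightarrow> a mod m = b mod m"
  by (simp add: mod_eq_dvd_iff)

text \<open>Moving the head \<open>x\<close> to the end lowers every prefix sum by \<open>x\<close>
  and every prefix length by one; a common shift does not affect distinctness modulo
  \<open>m\<close>.\<close>

lemma simple_modulo_rotate1:
  assumes "sum_list xs = 0" and "simple_modulo m xs"
  shows "simple_modulo m (rotate1 xs)"
proof (cases xs)
  case (Cons x ys)
  have inj: "inj_on (\<lambda>k. sum_list (take k xs) mod m) {1..length xs}"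
    using assms by (simp add: simple_modulo_iff_inj_on_take)
  have "inj_on (\<lambda>k. sum_list (take k (ys @ [x])) mod m) {..<length (ys @ [x])}"
  proof (rule inj_onI)
    fix k l
    assume kl: "k \<in> {..<length (ys @ [x])}" "l \<in> {..<length (ys @ [x])}"
      and eq: "sum_list (take k (ys @ [x])) mod m = sum_list (take l (ys @ [x])) mod m"
    have "sum_list (take i (ys @ [x])) = sum_list (take (Suc i) xs) - x"
      if "i \<in> {..<length (ys @ [x])}" for i
      using that Cons by simp
    then have "sum_list (take (Suc k) xs) mod m = sum_list (take (Suc l) xs) mod m"
      using eq mod_eq_shift_iff[of _ x m] kl by metis
    then have "Suc k = Suc l"
      using inj_onD[OF inj, of "Suc k" "Suc l"] kl Cons by simp
    then show "k = l" by simp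
  qed
  then show ?thesis
    using Cons assms(1) by (subst simple_modulo_iff_inj_on_take_lessThan) simp_all
qed (use assms in simp)

lemma sum_list_rotate:
  fixes xs :: "'a::comm_monoid_add list"
  shows "sum_list (rotate k xs) = sum_list xs"
  by (metis add.commute append_take_drop_id rotate_drop_take sum_list_append)

lemma simple_modulo_rotate:
  assumes "sum_list xs = 0" and "simple_modulo m xs"
  shows "simple_modulo m (rotate k xs)"
  using assms by (induction k) (simp_all add: simple_modulo_rotate1 sum_list_rotate)

text \<open>A prefix of the reversed list is a reversed suffix; as the total is zero, it sums to
  minus the complementary prefix.\<close>

lemma simple_modulo_rev:
  assumes "sum_list xs = 0" and "simple_modulo m xs"
  shows "simple_modulo m (rev xs)"
proof -
  have inj: "inj_on (\<lambda>k. sum_list (take k xs) mod m) {1..length xs}"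
    using assms by (simp add: simple_modulo_iff_inj_on_take)
  have flip: "sum_list (take k (rev xs)) = 0 - sum_list (take (length xs - k) xs)" for k
  proof -
    have "sum_list (take (length xs - k) xs) + sum_list (drop (length xs - k) xs) = 0"
      using assms(1) by (metis append_take_drop_id sum_list_append)
    then show ?thesis
      by (simp add: take_rev sum_list_rev)
  qed
  have "inj_on (\<lambda>k. sum_list (take k (rev xs)) mod m) {..<length (rev xs)}"
  proof (rule inj_onI)
    fix k l
    assume kl: "k \<in> {..<length (rev xs)}" "l \<in> {..<length (rev xs)}"
      and eq: "sum_list (take k (rev xs)) mod m = sum_list (take l (rev xs)) mod m"
    have "sum_list (take (length xs - k) xs) mod m = sum_list (take (length xs - l) xs) mod m"
      using eq unfolding flip mod_eq_dvd_iff by (simp add: dvd_diff_commute)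
    then have "length xs - k = length xs - l"
      using inj_onD[OF inj] kl by simp
    then show "k = l" using kl by simp
  qed
  then show ?thesis
    using assms(1) by (subst simple_modulo_iff_inj_on_take_lessThan) (simp_all add: sum_list_rev)
qed

section \<open>Simplicity of lists with paired entries\<close>

lemma mod_eq_imp_eq_in_window:
  fixes x y m lo :: int
  assumes "x mod m = y mod m" and "lo \<le> x" "x < lo + m" "lo \<le> y" "y < lo + m"
  shows "x = y"
proof -
  have "(x - lo) mod m = (y - lo) mod m"
    using assms(1) by (simp add: mod_eq_shift_iff)
  then show ?thesis
    using assms by (simp add: mod_pos_pos_trivial)
qed

lemma less_of_less_Suc:
  fixes f :: "nat \<Rightarrow> int"
  assumes "\<And>i. Suc i < N \<Longrightarrow> f i < f (Suc i)" and "i < j" "j < N"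
  shows "f i < f j"
  using assms(2,3)
proof (induction j)
  case (Suc j)
  then show ?case
    using assms(1)[of j] by (cases "i = j") auto
qed simp

lemma eq_of_less_Suc:
  fixes f :: "nat \<Rightarrow> int"
  assumes "\<And>i. Suc i < N \<Longrightarrow> f i < f (Suc i)" and "i < N" "j < N" "f i = f j"
  shows "i = j"
  using less_of_less_Suc[of N f i j] less_of_less_Suc[of N f j i] assms
  by (metis less_irrefl linorder_neqE_nat)

text \<open>The partial sums fall into four classes \<open>-j u\<close>, \<open>x (2 j) - j u\<close>, \<open>b - (p - k) u\<close> and
  \<open>b - (p - k) u + x (2 p + 1 + 2 k)\<close>, where \<open>b = x (2 p)\<close>. The hypotheses make these
  classes lie one above the other, inside an interval shorter than the modulus.\<close>

lemma simple_modulo_paired: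
  fixes x :: "nat \<Rightarrow> int" and u m :: int
  assumes p: "p > 0" and u: "u > 0"
    and lower: "\<And>j. j < p \<Longrightarrow> x (2 * j) + x (2 * j + 1) = - u"
    and upper: "\<And>k. k < p - 1 \<Longrightarrow> x (2 * p + 1 + 2 * k) + x (2 * p + 2 + 2 * k) = u"
    and middle: "x (2 * p) + x (4 * p - 1) = u"
    and lower_step: "\<And>j. Suc j < p \<Longrightarrow> x (2 * j) + u < x (2 * Suc j)"
    and upper_step: "\<And>k. Suc k < p - 1 \<Longrightarrow> x (2 * p + 1 + 2 * k) < x (2 * p + 1 + 2 * Suc k)"
    and lower_first: "0 < x 0"
    and lower_last: "x (2 * (p - 1)) + u < x (2 * p)"
    and upper_first: "\<And>k. k < p - 1 \<Longrightarrow> int (p - 1) * u < x (2 * p + 1 + 2 * k)"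
    and upper_last: "\<And>k. k < p - 1 \<Longrightarrow> x (2 * p) + x (2 * p + 1 + 2 * k) + int p * u < m + 2 * u"
    and middle_bound: "x (2 * p) + int p * u < m + u"
  shows "sum_list (map x [0..<4 * p]) = 0 \<and> simple_modulo m (map x [0..<4 * p])"
proof -
  define P where "P k = (\<Sum>i<k. x i)" for k
  \<comment> \<open>In the classes \<open>E\<close> every adjacent pair read so far is complete, in
    the classes \<open>O\<close> one is cut in half; \<open>1\<close> and \<open>2\<close> mean
    before and after the entry \<open>x (2 * p)\<close>, whose partner is the last entry.\<close>
  define O1 where "O1 j = x (2 * j) - int j * u" for j
  define E2 where "E2 k = x (2 * p) - int (p - k) * u" for k
  define O2 where "O2 k = E2 k + x (2 * p + 1 + 2 * k)" for k
  have P_Suc: "P (Suc k) = P k + x k" for k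
    by (simp add: P_def)
  have E1: "P (2 * j) = - (int j * u)" if "j \<le> p" for j
    using that
  proof (induction j)
    case (Suc j)
    then show ?case
      using lower[of j] P_Suc[of "2 * j"] P_Suc[of "2 * j + 1"] by (simp add: algebra_simps)
  qed (simp add: P_def)
  have O1: "P (2 * j + 1) = O1 j" if "j < p" for j
    using E1[of j] P_Suc[of "2 * j"] that by (simp add: O1_def)
  have E2: "P (2 * p + 1 + 2 * k) = E2 k" if "k \<le> p - 1" for k
    using that
  proof (induction k)
    case 0
    then show ?case
      using E1[of p] P_Suc[of "2 * p"] by (simp add: E2_def)
  next
    case (Suc k)
    then have "int (p - k) = int (p - Suc k) + 1" by simp
    then show ?case
      using Suc upper[of k] P_Suc[of "2 * p + 1 + 2 * k"] P_Suc[of "2 * p + 2 + 2 * k"]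
      by (simp add: E2_def algebra_simps)
  qed
  have O2: "P (2 * p + 2 + 2 * k) = O2 k" if "k < p - 1" for k
    using E2[of k] P_Suc[of "2 * p + 1 + 2 * k"] that by (simp add: O2_def)
  have "P (4 * p - 1) = E2 (p - 1)"
  proof -
    have "2 * p + 1 + 2 * (p - 1) = 4 * p - 1" using p by simp
    then show ?thesis using E2[of "p - 1"] by simp
  qed
  then have total: "P (4 * p) = 0"
    using P_Suc[of "4 * p - 1"] p middle by (simp add: E2_def)
  have P_list: "sum_list (take k (map x [0..<4 * p])) = P k" if "k \<le> 4 * p" for k
    using that by (simp add: take_map P_def interv_sum_list_conv_sum_set_nat atLeast0LessThan)
  have zero: "sum_list (map x [0..<4 * p]) = 0"
    using P_list[of "4 * p"] total by simp

  have O1_step: "O1 j < O1 (Suc j)" if "Suc j < p" for j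
    using lower_step[OF that] by (simp add: O1_def algebra_simps)
  have E2_step: "E2 k < E2 (Suc k)" if "Suc k < p" for k
  proof -
    have "int (p - k) = int (p - Suc k) + 1" using that by simp
    then show ?thesis using u by (simp add: E2_def algebra_simps)
  qed
  have O2_step: "O2 k < O2 (Suc k)" if "Suc k < p - 1" for k
    using add_strict_mono[OF E2_step[of k] upper_step[OF that]] that by (simp add: O2_def)
  have O1_lo: "0 < O1 j" if "j < p" for j
    using less_of_less_Suc[of p O1 0 j, OF O1_step] that lower_first
    by (cases "j = 0") (auto simp: O1_def)
  have O1_hi: "O1 j < E2 0" if "j < p" for j
  proof -
    have "int (p - 1) = int p - 1" using p by simp
    then have "O1 (p - 1) < E2 0"
      using lower_last by (simp add: O1_def E2_def algebra_simps)
    moreover have "O1 j \<le> O1 (p - 1)"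
    proof (cases "j = p - 1")
      case False
      then have "j < p - 1" "p - 1 < p" using that by simp_all
      then show ?thesis
        using less_of_less_Suc[of p O1 j "p - 1", OF O1_step] by simp
    qed simp
    ultimately show ?thesis by simp
  qed
  have E2_lo: "E2 0 \<le> E2 k" if "k < p" for k
    using less_of_less_Suc[of p E2 0 k, OF E2_step] that by (cases "k = 0") auto
  have E2_hi: "E2 k \<le> x (2 * p) - u" if "k < p" for k
  proof -
    have "u \<le> int (p - k) * u" using that u by simp
    then show ?thesis by (simp add: E2_def)
  qed
  have O2_lo: "x (2 * p) - u < O2 k" if "k < p - 1" for k
  proof -
    have "int (p - 1) = int p - 1" using p by simp
    \<comment> \<open>The class \<open>E2\<close> climbs by \<open>u\<close> at each step, over a
      height of \<open>(p - 1) * u\<close>. An entry larger than this, added even to the lowest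
      \<open>E2\<close>, clears the top of the class.\<close>
    then have "E2 0 + int (p - 1) * u = x (2 * p) - u"
      by (simp add: E2_def algebra_simps)
    moreover have "E2 0 \<le> E2 k"
      using E2_lo[of k] that by simp
    ultimately show ?thesis
      using upper_first[OF that] unfolding O2_def by linarith
  qed
  have O2_hi: "O2 k < m - int p * u" if "k < p - 1" for k
  proof -
    \<comment> \<open>Here \<open>k < p - 1\<close> gives \<open>p - k \<ge> 2\<close>, the source
      of the term \<open>2 * u\<close> in \<open>upper_last\<close>.\<close>
    have "2 * u \<le> int (p - k) * u" using that u by simp
    then show ?thesis
      using upper_last[OF that] by (simp add: O2_def E2_def)
  qed

  have split: "(\<exists>j\<le>p. i = 2 * j) \<or> (\<exists>j<p. i = 2 * j + 1) \<or> (\<exists>k<p. i = 2 * p + 1 + 2 * k)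
      \<or> (\<exists>k<p - 1. i = 2 * p + 2 + 2 * k)" if "i < 4 * p" for i
    using that by presburger
  have E1_eq: "P i \<le> 0 \<and> - (int p * u) \<le> P i" if "j \<le> p" "i = 2 * j" for i j
    using that E1[of j] u by (simp add: mult_right_mono)
  \<comment> \<open>The lowest partial sum is \<open>P (2 * p)\<close>, when all negative pairs have
    been read. For the first three classes the upper end comes from \<open>middle_bound\<close>, as
    \<open>O2\<close> is empty when \<open>p = 1\<close>.\<close>
  have window: "- (int p * u) \<le> P i \<and> P i < - (int p * u) + m" if "i < 4 * p" for i
  proof -
    have "- (int p * u) \<le> 0" using u by simp
    moreover have "x (2 * p) - u < m - int p * u" using middle_bound by simp
    ultimately show ?thesis
      using split[OF that]
      apply (elim disjE exE conjE)
      subgoal for j using E1_eq[of j i] O1_lo[of 0] O1_hi[of 0] E2_hi[of 0] p by linarith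
      subgoal for j using O1[of j] O1_lo[of j] O1_hi[of j] E2_hi[of 0] p by simp
      subgoal for k using E2[of k] O1_lo[of 0] O1_hi[of 0] E2_lo[of k] E2_hi[of k] p by simp
      subgoal for k using O2[of k] O1_lo[of 0] O1_hi[of 0] E2_hi[of 0] O2_lo[of k] O2_hi[of k] p by simp
      done
  qed
  \<comment> \<open>The value alone tells the class, and within a class the sums are strictly
    monotone, decreasing in \<open>E1\<close> and increasing in the others, so the index is
    recovered.\<close>
  have P_inj: "i = l" if "i < 4 * p" "l < 4 * p" "P i = P l" for i l
  proof -
    have E1_inj: "j = j'" if "P (2 * j) = P (2 * j')" "j \<le> p" "j' \<le> p" for j j'
      using that E1[of j] E1[of j'] u by simp
    have bounds: "0 < O1 0" "O1 0 < E2 0" "E2 0 \<le> x (2 * p) - u"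
      using O1_lo[of 0] O1_hi[of 0] E2_hi[of 0] p by simp_all
    have in_E1: "\<exists>j\<le>p. i = 2 * j" if "i < 4 * p" "P i \<le> 0" for i
      using split[OF that(1)] that(2) O1 O1_lo E2 E2_lo O2 O2_lo bounds by force
    have in_O1: "\<exists>j<p. i = 2 * j + 1" if "i < 4 * p" "0 < P i" "P i < E2 0" for i
      using split[OF that(1)] that(2,3) E1_eq[of _ i] E2 E2_lo O2 O2_lo bounds by force
    have in_E2: "\<exists>k<p. i = 2 * p + 1 + 2 * k" if "i < 4 * p" "E2 0 \<le> P i" "P i \<le> x (2 * p) - u" for i
      using split[OF that(1)] that(2,3) E1_eq[of _ i] O1 O1_hi O2 O2_lo bounds by force
    have in_O2: "\<exists>k<p - 1. i = 2 * p + 2 + 2 * k" if "i < 4 * p" "x (2 * p) - u < P i" for i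
      using split[OF that(1)] that(2) E1_eq[of _ i] O1 O1_hi E2 E2_hi bounds by force
    note same = \<open>i < 4 * p\<close> \<open>l < 4 * p\<close> \<open>P i = P l\<close>
    consider "P i \<le> 0" | "0 < P i" "P i < E2 0" | "E2 0 \<le> P i" "P i \<le> x (2 * p) - u"
      | "x (2 * p) - u < P i"
      by linarith
    then show ?thesis
    proof cases
      case 1
      then show ?thesis using in_E1[of i] in_E1[of l] E1_inj same by metis
    next
      case 2
      then obtain j j' where "j < p" "i = 2 * j + 1" "j' < p" "l = 2 * j' + 1"
        using in_O1[of i] in_O1[of l] same by metis
      then show ?thesis
        using eq_of_less_Suc[of p O1 j j', OF O1_step] O1 same(3) by simp
    next
      case 3
      then obtain k k' where "k < p" "i = 2 * p + 1 + 2 * k" "k' < p" "l = 2 * p + 1 + 2 * k'"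
        using in_E2[of i] in_E2[of l] same by metis
      then show ?thesis
        using eq_of_less_Suc[of p E2 k k', OF E2_step] E2[of k] E2[of k'] same(3) by simp
    next
      case 4
      then obtain k k' where "k < p - 1" "i = 2 * p + 2 + 2 * k" "k' < p - 1" "l = 2 * p + 2 + 2 * k'"
        using in_O2[of i] in_O2[of l] same by metis
      then show ?thesis
        using eq_of_less_Suc[of "p - 1" O2 k k', OF O2_step] O2[of k] O2[of k'] same(3) by simp
    qed
  qed
  have "simple_modulo m (map x [0..<4 * p])"
  proof (subst simple_modulo_iff_inj_on_take_lessThan[OF zero], rule inj_onI)
    fix i l
    assume "i \<in> {..<length (map x [0..<4 * p])}" "l \<in> {..<length (map x [0..<4 * p])}"
      "sum_list (take i (map x [0..<4 * p])) mod m = sum_list (take l (map x [0..<4 * p])) mod m"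
    then have il: "i < 4 * p" "l < 4 * p" and "P i mod m = P l mod m"
      by (simp_all add: P_list)
    then have "P i = P l"
      using mod_eq_imp_eq_in_window window by blast
    then show "i = l" using P_inj il by blast
  qed
  then show ?thesis using zero by blast
qed

section \<open>Order in which rows and columns meet the diagonals\<close>

lemma map_filter_append: "List.map_filter f (xs @ ys) = List.map_filter f xs @ List.map_filter f ys"
  by (simp add: List.map_filter_def)

lemma map_filter_map: "List.map_filter f (map g xs) = List.map_filter (f \<circ> g) xs"
  by (simp add: List.map_filter_def filter_map comp_def)

lemma map_filter_cong:
  assumes "\<And>x. x \<in> set xs \<Longrightarrow> f x = g x"
  shows "List.map_filter f xs = List.map_filter g xs"
  using assms by (induction xs) (auto split: option.split)

lemma map_filter_rev: "List.map_filter f (rev xs) = rev (List.map_filter f xs)"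
  by (simp add: List.map_filter_def rev_filter rev_map)

lemma append_eq_rotate: "\<exists>k. xs @ ys = rotate k (ys @ xs)"
  by (metis rotate_append)

text \<open>Cell \<open>(r, c)\<close> lies on diagonal \<open>r - c\<close> modulo
  \<open>n\<close>. From left to right this index descends, wrapping once after
  \<open>c = r\<close>; hence the reversed intervals for rows, whereas columns run through the
  diagonals upwards.\<close>

lemma map_diff_mod_decreasing:
  assumes "r < n"
  shows "map (\<lambda>c. (r + n - c) mod n) [0..<n] = rev [0..<Suc r] @ rev [Suc r..<n]"
proof (rule nth_equalityI)
  fix c assume "c < length (map (\<lambda>c. (r + n - c) mod n) [0..<n])"
  then have "c < n" by simp
  show "map (\<lambda>c. (r + n - c) mod n) [0..<n] ! c = (rev [0..<Suc r] @ rev [Suc r..<n]) ! c"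
  proof (cases "c \<le> r")
    case True
    then have "(r + n - c) mod n = r - c"
      using assms by (simp add: mod_if)
    then show ?thesis
      using True \<open>c < n\<close> by (simp add: nth_append rev_nth del: upt_Suc)
  next
    case False
    then show ?thesis
      using assms \<open>c < n\<close> by (simp add: nth_append rev_nth del: upt_Suc)
  qed
qed (use assms in simp)

lemma map_diff_mod_increasing:
  assumes "c < n"
  shows "map (\<lambda>r. (r + n - c) mod n) [0..<n] = [n - c..<n] @ [0..<n - c]"
proof (rule nth_equalityI)
  fix r assume "r < length (map (\<lambda>r. (r + n - c) mod n) [0..<n])"
  then have "r < n" by simp
  show "map (\<lambda>r. (r + n - c) mod n) [0..<n] ! r = ([n - c..<n] @ [0..<n - c]) ! r"
  proof (cases "c \<le> r")
    case True
    then have "(r + n - c) mod n = r - c"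
      using \<open>r < n\<close> by (simp add: mod_if)
    then show ?thesis
      using True \<open>r < n\<close> assms by (simp add: nth_append)
  next
    case False
    then show ?thesis
      using assms \<open>r < n\<close> by (simp add: nth_append)
  qed
qed (use assms in simp)

lemma mod_shift_back:
  fixes a k n :: nat
  assumes "k \<le> n"
  shows "((a + k) mod n + n - k) mod n = a mod n"
proof -
  have "(a + k) mod n + n - k = (a + k) mod n + (n - k)"
    using assms by simp
  then have "((a + k) mod n + n - k) mod n = (a + k + (n - k)) mod n"
    by (simp add: mod_add_left_eq)
  then show ?thesis using assms by simp
qed

section \<open>The construction\<close>

text \<open>The bounds on \<open>\<alpha>\<close> place the isolated diagonal after the
  \<open>4 * p - 1\<close> consecutive ones and inside the array.\<close>

locale heffter_construction =
  fixes p n \<gamma> \<alpha> \<beta> :: nat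
  assumes p_pos: "p > 0" and n_ge: "4 * p \<le> n"
    and \<alpha>_ge: "2 * p - 1 \<le> \<alpha>" and \<alpha>_less: "2 * p + \<alpha> < n"
    and inverse: "(\<beta> * \<alpha>) mod n = 1"
begin

text \<open>Division by \<open>\<alpha>\<close> modulo \<open>n\<close>: the number of steps of
  length \<open>\<alpha>\<close> that lead from row \<open>0\<close> to row
  \<open>r\<close>.\<close>

definition twist :: "nat \<Rightarrow> nat" where
  "twist r = (\<beta> * r) mod n"

definition diag :: "nat \<Rightarrow> nat" where
  "diag i = (if i = 4 * p - 1 then 2 * p + \<alpha> else i)"

text \<open>In the first \<open>p\<close> pairs the positive diagonal has the lower of the two
  adjacent blocks, in the last \<open>p\<close> pairs the upper one; this decides the sign of the
  pair sums. The pair of \<open>2 * p\<close> and \<open>4 * p - 1\<close> takes blocks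
  \<open>2 * p + 1\<close> and \<open>2 * p\<close>, which moves the odd indices in between up by
  two.\<close>

definition block :: "nat \<Rightarrow> nat" where
  "block i = (if i = 2 * p then 2 * p + 1 else if i = 4 * p - 1 then 2 * p
     else if 2 * p < i \<and> odd i then i + 2 else i)"

text \<open>The first member of every pair is positive; the last diagonal closes the pair opened by
  \<open>2 * p\<close>.\<close>

definition pos :: "nat \<Rightarrow> bool" where
  "pos i \<longleftrightarrow> (if i \<le> 2 * p then even i else odd i \<and> i \<noteq> 4 * p - 1)"

text \<open>On the diagonals \<open>2 p\<close> and \<open>2 p + \<alpha>\<close> consecutive values are \<open>\<alpha>\<close> rows apart, which
  is why the offset there goes through the inverse \<open>\<beta>\<close> of \<open>\<alpha>\<close>. On every pair of diagonals the
  jump in the offset is placed in row \<open>0\<close>.\<close>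

definition offset :: "nat \<Rightarrow> nat \<Rightarrow> nat" where
  "offset i r = (if i = 2 * p then twist r else if i = 4 * p - 1 then twist ((r + n - \<alpha>) mod n)
     else if i < 2 * p then (if even i then n - 1 - r else n - 1 - (r + n - 1) mod n)
     else if odd i then r else (r + n - 1) mod n)"

definition magnitude :: "nat \<Rightarrow> nat \<Rightarrow> nat" where
  "magnitude i r = (\<gamma> + block i) * n + 1 + offset i r"

definition entry :: "nat \<Rightarrow> nat \<Rightarrow> int" where
  "entry i r = (if pos i then int (magnitude i r) else - int (magnitude i r))"

definition on_diagonal :: "nat \<Rightarrow> (nat \<Rightarrow> 'a) \<Rightarrow> 'a option" where
  "on_diagonal d f = (if d < 4 * p - 1 then Some (f d)
     else if d = 2 * p + \<alpha> then Some (f (4 * p - 1)) else None)"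

definition array :: heffter_array where
  "array r c = on_diagonal ((r + n - c) mod n) (\<lambda>i. entry i r)"

section \<open>Cells and lines of the array\<close>

lemma n_pos: "0 < n" and n_gt_1: "1 < n"
  using n_ge p_pos by simp_all

lemma diag_less: "i < 4 * p \<Longrightarrow> diag i < n"
  using n_ge \<alpha>_less by (simp add: diag_def)

lemma on_diagonal_diag: "i < 4 * p \<Longrightarrow> on_diagonal (diag i) f = Some (f i)"
  using \<alpha>_ge p_pos by (auto simp: on_diagonal_def diag_def)

lemma on_diagonal_eq_Some_iff:
  "on_diagonal d f = Some x \<longleftrightarrow> (\<exists>i<4 * p. d = diag i \<and> x = f i)"
proof -
  have "\<exists>i<4 * p. d = diag i" if "on_diagonal d f = Some x"
  proof (cases "d < 4 * p - 1")
    case True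
    then show ?thesis by (intro exI[of _ d]) (simp add: diag_def)
  next
    case False
    then show ?thesis
      using that p_pos by (intro exI[of _ "4 * p - 1"]) (auto simp: diag_def on_diagonal_def split: if_splits)
  qed
  then show ?thesis using on_diagonal_diag by fastforce
qed

text \<open>\<open>diag\<close> is increasing, so filtering keeps the ranks in sequence. The
  diagonal number is passed to \<open>f\<close> as well because along a column the row of a cell
  depends on it.\<close>

lemma map_filter_on_diagonal:
  "List.map_filter (\<lambda>d. on_diagonal d (f d)) [0..<n] = map (\<lambda>i. f (diag i) i) [0..<4 * p]"
proof -
  let ?F = "\<lambda>d. on_diagonal d (f d)"
  have up: "[0..<n] = [0..<4 * p - 1] @ [4 * p - 1..<2 * p + \<alpha>] @ [2 * p + \<alpha>] @ [Suc (2 * p + \<alpha>)..<n]"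
  proof -
    have "[2 * p + \<alpha>..<n] = [2 * p + \<alpha>] @ [Suc (2 * p + \<alpha>)..<n]"
      using \<alpha>_less upt_conv_Cons by simp
    moreover have "[0..<n] = [0..<4 * p - 1] @ [4 * p - 1..<n]"
      using n_ge upt_add_eq_append[of 0 "4 * p - 1" "n - (4 * p - 1)"] by simp
    moreover have "[4 * p - 1..<n] = [4 * p - 1..<2 * p + \<alpha>] @ [2 * p + \<alpha>..<n]"
      using \<alpha>_ge \<alpha>_less upt_add_eq_append[of "4 * p - 1" "2 * p + \<alpha>" "n - (2 * p + \<alpha>)"] by simp
    ultimately show ?thesis by simp
  qed
  have none: "List.map_filter ?F xs = []" if "\<forall>d\<in>set xs. ?F d = None" for xs
    using that by (induction xs) auto
  have some: "List.map_filter ?F xs = map g xs" if "\<forall>d\<in>set xs. ?F d = Some (g d)" for xs g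
    using that by (induction xs) auto
  have "List.map_filter ?F [0..<4 * p - 1] = map (\<lambda>i. f (diag i) i) [0..<4 * p - 1]"
    by (intro some) (simp add: on_diagonal_def diag_def)
  moreover have "List.map_filter ?F [4 * p - 1..<2 * p + \<alpha>] = []"
    by (intro none) (simp add: on_diagonal_def)
  moreover have "List.map_filter ?F [Suc (2 * p + \<alpha>)..<n] = []"
    using \<alpha>_ge by (intro none) (auto simp: on_diagonal_def)
  moreover have "List.map_filter ?F [2 * p + \<alpha>] = [f (diag (4 * p - 1)) (4 * p - 1)]"
  proof -
    have "\<not> 2 * p + \<alpha> < 4 * p - 1" using \<alpha>_ge by linarith
    then show ?thesis by (simp add: on_diagonal_def diag_def)
  qed
  moreover have "[0..<4 * p] = [0..<4 * p - 1] @ [4 * p - 1]"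
    using p_pos upt_Suc_append[of 0 "4 * p - 1"] by simp
  ultimately show ?thesis
    by (simp only: up map_filter_append map_append) simp
qed

text \<open>The amount of rotation depends on where the line starts among the diagonals; any amount
  will do, since zero sum and simplicity survive rotation.\<close>

lemma row_entries_array:
  assumes "r < n"
  shows "\<exists>k. row_entries n array r = rotate k (rev (map (\<lambda>i. entry i r) [0..<4 * p]))"
proof -
  let ?F = "\<lambda>d. on_diagonal d (\<lambda>i. entry i r)"
  let ?L = "List.map_filter ?F (rev [0..<Suc r])" and ?R = "List.map_filter ?F (rev [Suc r..<n])"
  have "row_entries n array r = List.map_filter ?F (map (\<lambda>c. (r + n - c) mod n) [0..<n])"
    by (simp add: row_entries_def map_filter_map comp_def array_def)
  then have 1: "row_entries n array r = ?L @ ?R"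
    using assms by (simp only: map_diff_mod_decreasing map_filter_append)
  have "[0..<Suc r] @ [Suc r..<n] = [0..<n]"
    using assms upt_add_eq_append[of 0 "Suc r" "n - Suc r"] by simp
  then have "?R @ ?L = rev (List.map_filter ?F [0..<n])"
    by (metis map_filter_append map_filter_rev rev_append)
  then have "?R @ ?L = rev (map (\<lambda>i. entry i r) [0..<4 * p])"
    using map_filter_on_diagonal[of "\<lambda>d i. entry i r"] by simp
  then show ?thesis
    using 1 append_eq_rotate[of ?L ?R] by simp
qed

lemma col_entries_array:
  assumes "c < n"
  shows "\<exists>k. col_entries n array c = rotate k (map (\<lambda>i. entry i ((c + diag i) mod n)) [0..<4 * p])"
proof -
  let ?F = "\<lambda>d. on_diagonal d (\<lambda>i. entry i ((c + d) mod n))"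
  let ?L = "List.map_filter ?F [n - c..<n]" and ?R = "List.map_filter ?F [0..<n - c]"
  \<comment> \<open>A cell of column \<open>c\<close> is determined by its diagonal
    \<open>d\<close>: its row is \<open>c + d\<close> modulo \<open>n\<close>. This expresses the
    entries through \<open>d\<close> alone.\<close>
  have row: "(c + (r + n - c) mod n) mod n = r" if "r < n" for r
    using assms that by (simp add: mod_add_right_eq)
  have "col_entries n array c = List.map_filter (?F \<circ> (\<lambda>r. (r + n - c) mod n)) [0..<n]"
    unfolding col_entries_def by (rule map_filter_cong) (simp add: array_def row)
  also have "\<dots> = List.map_filter ?F (map (\<lambda>r. (r + n - c) mod n) [0..<n])"
    by (simp add: map_filter_map)
  finally have 1: "col_entries n array c = ?L @ ?R"
    using assms by (simp only: map_diff_mod_increasing map_filter_append)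
  have "[0..<n - c] @ [n - c..<n] = [0..<n]"
    using assms upt_add_eq_append[of 0 "n - c" c] by simp
  then have "?R @ ?L = List.map_filter ?F [0..<n]"
    by (metis map_filter_append)
  then have "?R @ ?L = map (\<lambda>i. entry i ((c + diag i) mod n)) [0..<4 * p]"
    using map_filter_on_diagonal[of "\<lambda>d i. entry i ((c + d) mod n)"] by simp
  then show ?thesis
    using 1 append_eq_rotate[of ?L ?R] by simp
qed

lemma filled_cells_array:
  "filled_cells n array = (\<Union>d \<in> {0..4 * p - 2} \<union> {2 * p + \<alpha>}. diagonal n d)"
proof -
  have diags: "{0..4 * p - 2} \<union> {2 * p + \<alpha>} = diag ` {..<4 * p}"
  proof -
    have "{..<4 * p} = insert (4 * p - 1) {0..4 * p - 2}" "4 * p - 1 \<notin> {0..4 * p - 2}"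
      using p_pos by auto
    moreover have "diag ` {0..4 * p - 2} = id ` {0..4 * p - 2}"
      using p_pos by (intro image_cong) (auto simp: diag_def)
    moreover have "diag (4 * p - 1) = 2 * p + \<alpha>"
      by (simp add: diag_def)
    ultimately show ?thesis
      by (simp only: image_insert) simp
  qed
  have iff: "(r, c) \<in> diagonal n d \<longleftrightarrow> r < n \<and> c < n \<and> (r + n - c) mod n = d" if "d < n" for r c d
  proof
    assume "(r, c) \<in> diagonal n d"
    then have "c < n" "r = (c + d) mod n"
      by (auto simp: diagonal_def)
    moreover have "((c + d) mod n + n - c) mod n = d"
      using \<open>d < n\<close> \<open>c < n\<close> by (cases "c + d < n") (simp_all add: mod_if)
    ultimately show "r < n \<and> c < n \<and> (r + n - c) mod n = d"
      using n_pos by simp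
  next
    assume "r < n \<and> c < n \<and> (r + n - c) mod n = d"
    then have "c < n" "r = (c + d) mod n"
      by (auto simp: mod_add_right_eq)
    then show "(r, c) \<in> diagonal n d"
      by (auto simp: diagonal_def add.commute)
  qed
  show ?thesis
    unfolding diags filled_cells_def array_def
    by (auto simp: iff diag_less on_diagonal_eq_Some_iff)
qed

section \<open>Offsets, blocks and the support\<close>

lemma coprime_\<beta>: "coprime \<beta> n"
proof -
  have "coprime (\<beta> * \<alpha>) n"
    using inverse by (metis coprime_mod_left_iff coprime_1_left n_pos not_gr_zero)
  then show ?thesis by simp
qed

lemma twist_less: "twist r < n"
  using n_pos by (simp add: twist_def)

lemma twist_0: "twist 0 = 0"
  by (simp add: twist_def)

lemma twist_pos: "0 < r \<Longrightarrow> r < n \<Longrightarrow> 0 < twist r"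
  using coprime_\<beta> by (metis coprime_commute coprime_dvd_mult_right_iff dvd_eq_mod_eq_0 gr0I nat_dvd_not_less twist_def)

text \<open>Modulo \<open>n\<close>, \<open>\<beta> * (r - \<alpha>)\<close> is
  \<open>\<beta> * r - 1\<close>: going back \<open>\<alpha>\<close> rows lowers
  \<open>twist\<close> by one. The wrap from \<open>0\<close> to \<open>n - 1\<close> occurs where
  \<open>twist r = 0\<close>, hence only in row \<open>0\<close>.\<close>

lemma twist_shift: "(twist ((r + n - \<alpha>) mod n) + 1) mod n = twist r"
proof -
  have "\<beta> * (r + n - \<alpha>) + \<beta> * \<alpha> = \<beta> * r + \<beta> * n"
    using \<alpha>_less by (simp flip: distrib_left)
  then have "(\<beta> * (r + n - \<alpha>) + \<beta> * \<alpha>) mod n = twist r"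
    by (simp add: twist_def)
  then show ?thesis
    using inverse by (metis mod_add_left_eq mod_add_right_eq mod_mult_right_eq twist_def)
qed

lemma twist_shift_0: "twist ((0 + n - \<alpha>) mod n) = n - 1"
  using twist_shift[of 0] twist_less[of "(0 + n - \<alpha>) mod n"] twist_0
  by (cases "twist ((0 + n - \<alpha>) mod n) + 1 < n") auto

lemma twist_shift_pos: "0 < r \<Longrightarrow> r < n \<Longrightarrow> twist r = twist ((r + n - \<alpha>) mod n) + 1"
  using twist_shift[of r] twist_less[of "(r + n - \<alpha>) mod n"] twist_pos[of r]
  by (cases "twist ((r + n - \<alpha>) mod n) + 1 = n") auto

lemma twist_surj: "t < n \<Longrightarrow> \<exists>r<n. twist r = t"
proof (intro exI conjI)
  assume "t < n"
  have "twist ((\<alpha> * t) mod n) = ((\<beta> * \<alpha>) mod n * t) mod n"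
    by (simp add: twist_def mod_mult_right_eq mod_mult_left_eq mult.assoc)
  then show "twist ((\<alpha> * t) mod n) = t"
    using inverse \<open>t < n\<close> by simp
qed (use n_pos in simp)

lemma shift_surj:
  assumes "s < n" and "k \<le> n"
  shows "\<exists>r<n. (r + n - k) mod n = s"
proof (intro exI conjI)
  show "((s + k) mod n + n - k) mod n = s"
    using assms by (cases "s + k < n") (auto simp: mod_if)
qed (use n_pos in simp)

lemma offset_less: "r < n \<Longrightarrow> offset i r < n"
  using n_pos twist_less by (simp add: offset_def)

lemma offset_surj:
  assumes "t < n"
  shows "\<exists>r<n. offset i r = t"
proof -
  have flip: "n - 1 - (n - 1 - t) = t" "n - 1 - t < n"
    using assms by auto
  show ?thesis
    \<comment> \<open>Even diagonals below \<open>2 * p\<close> reach \<open>t\<close> at its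
      reflection \<open>n - 1 - t\<close>, odd ones one row later, cyclically. Diagonal
      \<open>4 * p - 1\<close> combines \<open>twist_surj\<close> with a shift by
      \<open>\<alpha>\<close>.\<close>
    using assms flip twist_surj[OF assms] shift_surj[of _ \<alpha>] shift_surj[of t 1] shift_surj[of "n - 1 - t" 1]
      n_pos \<alpha>_less
    unfolding offset_def by (smt (verit) add_leE less_imp_le_nat less_one not_le)
qed

lemma block_less: "i < 4 * p \<Longrightarrow> block i < 4 * p"
  unfolding block_def using p_pos by (simp; presburger)

lemma block_surj:
  assumes "q < 4 * p"
  shows "\<exists>i<4 * p. block i = q"
proof -
  consider "q < 2 * p" | "q = 2 * p" | "q = 2 * p + 1" | "2 * p + 1 < q" "even q" | "2 * p + 1 < q" "odd q"
    by linarith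
  then show ?thesis
  proof cases
    case 1
    then show ?thesis by (intro exI[of _ q]) (auto simp: block_def)
  next
    case 2
    then show ?thesis using p_pos by (intro exI[of _ "4 * p - 1"]) (auto simp: block_def)
  next
    case 3
    then show ?thesis using assms by (intro exI[of _ "2 * p"]) (auto simp: block_def)
  next
    case 4
    moreover have "odd (4 * p - 1)" using p_pos by simp
    ultimately have "q \<noteq> 4 * p - 1" by blast
    then show ?thesis using assms 4 by (intro exI[of _ q]) (auto simp: block_def)
  next
    case 5
    \<comment> \<open>An odd \<open>q\<close> above \<open>2 * p + 1\<close> is at least
      \<open>2 * p + 3\<close>, so \<open>q - 2\<close> is an odd index above \<open>2 * p\<close>;
      being at most \<open>4 * p - 3\<close>, it is not the last.\<close>
    moreover from 5 have "2 * p + 2 < q" "odd (q - 2)"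
      by (presburger, simp)
    ultimately show ?thesis using assms by (intro exI[of _ "q - 2"]) (auto simp: block_def)
  qed
qed

lemma abs_entry: "\<bar>entry i r\<bar> = int (magnitude i r)"
  by (simp add: entry_def)

lemma magnitude_bounds:
  assumes "i < 4 * p" "r < n"
  shows "\<gamma> * n + 1 \<le> magnitude i r" "magnitude i r \<le> (4 * p + \<gamma>) * n"
proof -
  have "(\<gamma> + block i + 1) * n \<le> (4 * p + \<gamma>) * n"
    using block_less[OF assms(1)] by (intro mult_le_mono) auto
  then show "\<gamma> * n + 1 \<le> magnitude i r" "magnitude i r \<le> (4 * p + \<gamma>) * n"
    using offset_less[OF assms(2), of i] by (simp_all add: magnitude_def algebra_simps)
qed

text \<open>Division with remainder by \<open>n\<close>, after subtracting
  \<open>\<gamma> * n + 1\<close>: the quotient picks the block and so the diagonal, the remainder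
  the offset and so the row.\<close>

lemma magnitude_surj:
  assumes "\<gamma> * n + 1 \<le> v" "v \<le> (4 * p + \<gamma>) * n"
  shows "\<exists>i<4 * p. \<exists>r<n. magnitude i r = v"
proof -
  define w where "w = v - (\<gamma> * n + 1)"
  have "w < 4 * p * n"
    using assms n_pos by (simp add: w_def algebra_simps)
  then have "w div n < 4 * p"
    by (simp add: less_mult_imp_div_less)
  then obtain i where i: "i < 4 * p" "block i = w div n"
    using block_surj by blast
  obtain r where r: "r < n" "offset i r = w mod n"
    using offset_surj[of "w mod n" i] n_pos by auto
  have "magnitude i r = \<gamma> * n + 1 + (w div n * n + w mod n)"
    using i r by (simp add: magnitude_def algebra_simps)
  also have "\<dots> = v"
    using assms by (simp add: w_def)
  finally show ?thesis using i r by blast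
qed

lemma array_support_array: "array_support n array = {int (\<gamma> * n + 1)..int ((4 * p + \<gamma>) * n)}"
proof -
  \<comment> \<open>Row \<open>r\<close> meets diagonal \<open>d\<close> in column
    \<open>r - d\<close> modulo \<open>n\<close>, so every combination of a rank and a row occurs as
    a cell.\<close>
  have cell: "\<exists>c<n. (r + n - c) mod n = d" if "r < n" "d < n" for r d
  proof (intro exI conjI)
    show "(r + n - (r + n - d) mod n) mod n = d"
    proof (cases "d \<le> r")
      case True
      then have "(r + n - d) mod n = r - d"
        using that by (simp add: mod_if)
      then show ?thesis using True that by simp
    next
      case False
      then show ?thesis using that by simp
    qed
  qed (use n_pos in simp)
  have "array_support n array = {\<bar>entry i r\<bar> | i r. i < 4 * p \<and> r < n}"
    unfolding array_support_def array_def on_diagonal_eq_Some_iff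
    using cell diag_less by (auto; metis)
  also have "\<dots> = {int (magnitude i r) | i r. i < 4 * p \<and> r < n}"
    by (simp add: abs_entry)
  also have "\<dots> = {int (\<gamma> * n + 1)..int ((4 * p + \<gamma>) * n)}"
  proof (intro equalityI subsetI)
    fix v assume "v \<in> {int (\<gamma> * n + 1)..int ((4 * p + \<gamma>) * n)}"
    then have "int (\<gamma> * n + 1) \<le> v" "v \<le> int ((4 * p + \<gamma>) * n)" by auto
    moreover from this obtain w where w: "v = int w"
      by (metis nonneg_int_cases of_nat_0_le_iff order_trans)
    ultimately have "\<gamma> * n + 1 \<le> w" "w \<le> (4 * p + \<gamma>) * n"
      by (simp_all only: of_nat_le_iff)
    then show "v \<in> {int (magnitude i r) | i r. i < 4 * p \<and> r < n}"
      using magnitude_surj[of w] w by blast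
  next
    fix v assume "v \<in> {int (magnitude i r) | i r. i < 4 * p \<and> r < n}"
    then show "v \<in> {int (\<gamma> * n + 1)..int ((4 * p + \<gamma>) * n)}"
      using magnitude_bounds by (force simp del: of_nat_add of_nat_mult of_nat_Suc)
  qed
  finally show ?thesis .
qed

section \<open>Pair sums and simplicity of rows and columns\<close>

text \<open>Integer forms from which pair sums can be computed. Below \<open>2 * p\<close> the
  offsets run downwards, and the \<open>1\<close> of \<open>magnitude\<close> cancels. The cyclic
  predecessor stays symbolic, as it evaluates differently along rows and along columns.\<close>

lemma
  assumes "r < n"
  shows entry_lower_even: "j < p \<Longrightarrow> entry (2 * j) r = (int \<gamma> + 2 * int j) * int n + int n - int r"
    and entry_lower_odd: "j < p \<Longrightarrow> entry (2 * j + 1) r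
      = - ((int \<gamma> + 2 * int j + 1) * int n + int n - int ((r + n - 1) mod n))"
    and entry_middle: "entry (2 * p) r = (int \<gamma> + 2 * int p + 1) * int n + 1 + int (twist r)"
    and entry_last: "entry (4 * p - 1) r
      = - ((int \<gamma> + 2 * int p) * int n + 1 + int (twist ((r + n - \<alpha>) mod n)))"
    and entry_upper_odd: "k < p - 1 \<Longrightarrow> entry (2 * p + 1 + 2 * k) r
      = (int \<gamma> + 2 * int p + 3 + 2 * int k) * int n + 1 + int r"
    and entry_upper_even: "k < p - 1 \<Longrightarrow> entry (2 * p + 2 + 2 * k) r
      = - ((int \<gamma> + 2 * int p + 2 + 2 * int k) * int n + 1 + int ((r + n - 1) mod n))"
proof -
  have flip: "int (n - 1 - s) = int n - 1 - int s" if "s < n" for s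
    using that by linarith
  note defs = entry_def pos_def magnitude_def block_def offset_def
  show "entry (2 * j) r = (int \<gamma> + 2 * int j) * int n + int n - int r" if "j < p"
  proof -
    have "2 * j \<noteq> 2 * p" "2 * j \<noteq> 4 * p - 1" "2 * j < 2 * p" "even (2 * j)"
      using that by (simp, presburger, simp, simp)
    then have "entry (2 * j) r = int ((\<gamma> + 2 * j) * n + 1 + (n - 1 - r))"
      unfolding defs by simp
    then show ?thesis using flip[OF assms] by simp
  qed
  show "entry (2 * j + 1) r
      = - ((int \<gamma> + 2 * int j + 1) * int n + int n - int ((r + n - 1) mod n))" if "j < p"
  proof -
    have "2 * j + 1 \<noteq> 2 * p" "2 * j + 1 \<noteq> 4 * p - 1" "2 * j + 1 < 2 * p" "odd (2 * j + 1)"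
      using that by (presburger, presburger, simp, simp)
    then have "entry (2 * j + 1) r = - int ((\<gamma> + (2 * j + 1)) * n + 1 + (n - 1 - (r + n - 1) mod n))"
      unfolding defs by simp
    then show ?thesis using flip[of "(r + n - 1) mod n"] n_pos by (simp add: algebra_simps)
  qed
  show "entry (2 * p) r = (int \<gamma> + 2 * int p + 1) * int n + 1 + int (twist r)"
    unfolding defs by (simp add: algebra_simps)
  have "4 * p - 1 \<noteq> 2 * p" "\<not> 4 * p - 1 \<le> 2 * p"
    using p_pos by presburger+
  then show "entry (4 * p - 1) r
      = - ((int \<gamma> + 2 * int p) * int n + 1 + int (twist ((r + n - \<alpha>) mod n)))"
    unfolding defs by simp
  show "entry (2 * p + 1 + 2 * k) r
      = (int \<gamma> + 2 * int p + 3 + 2 * int k) * int n + 1 + int r" if "k < p - 1"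
  proof -
    define i where "i = 2 * p + 1 + 2 * k"
    have "i \<noteq> 2 * p" "i \<noteq> 4 * p - 1" "2 * p < i" "odd i"
      using that unfolding i_def by (presburger, presburger, simp, simp)
    then have "entry i r = int ((\<gamma> + (i + 2)) * n + 1 + r)"
      unfolding defs by simp
    then show ?thesis by (simp add: i_def algebra_simps)
  qed
  show "entry (2 * p + 2 + 2 * k) r
      = - ((int \<gamma> + 2 * int p + 2 + 2 * int k) * int n + 1 + int ((r + n - 1) mod n))" if "k < p - 1"
  proof -
    define i where "i = 2 * p + 2 + 2 * k"
    have "i \<noteq> 2 * p" "i \<noteq> 4 * p - 1" "2 * p < i" "even i"
      using that unfolding i_def by (presburger, presburger, simp, simp)
    then have "entry i r = - int ((\<gamma> + i) * n + 1 + (r + n - 1) mod n)"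
      unfolding defs by simp
    then show ?thesis by (simp add: i_def algebra_simps)
  qed
qed

text \<open>Common to rows and columns: \<open>\<rho> i\<close> is the row in which the line meets
  the \<open>i\<close>-th filled diagonal, and \<open>u\<close> is \<open>1\<close> or
  \<open>n + 1\<close> for rows, \<open>n\<close> for columns. \<open>lower_step\<close> is left to
  each case, since \<open>u \<le> n + 1\<close> and rows below \<open>n\<close> yield it only
  without strictness.\<close>

lemma simple_modulo_entries:
  fixes \<rho> :: "nat \<Rightarrow> nat" and u :: int
  assumes \<rho>: "\<And>i. i < 4 * p \<Longrightarrow> \<rho> i < n" and u: "0 < u" "u \<le> int n + 1"
    and lower: "\<And>j. j < p \<Longrightarrow> entry (2 * j) (\<rho> (2 * j)) + entry (2 * j + 1) (\<rho> (2 * j + 1)) = - u"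
    and upper: "\<And>k. k < p - 1 \<Longrightarrow> entry (2 * p + 1 + 2 * k) (\<rho> (2 * p + 1 + 2 * k))
      + entry (2 * p + 2 + 2 * k) (\<rho> (2 * p + 2 + 2 * k)) = u"
    and middle: "entry (2 * p) (\<rho> (2 * p)) + entry (4 * p - 1) (\<rho> (4 * p - 1)) = u"
    and lower_step: "\<And>j. Suc j < p \<Longrightarrow> u < 2 * int n + int (\<rho> (2 * j)) - int (\<rho> (2 * Suc j))"
  shows "sum_list (map (\<lambda>i. entry i (\<rho> i)) [0..<4 * p]) = 0
    \<and> simple_modulo (int (2 * (4 * p + \<gamma>) * n + 1)) (map (\<lambda>i. entry i (\<rho> i)) [0..<4 * p])"
proof -
  define x where "x i = entry i (\<rho> i)" for i
  define m where "m = int (2 * (4 * p + \<gamma>) * n + 1)"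
  define g N q where "g = int \<gamma>" and "N = int n" and "q = int p"
  have m: "m = 8 * (q * N) + 2 * (g * N) + 1"
    by (simp add: m_def g_def N_def q_def algebra_simps)
  have q: "1 \<le> q" and N: "4 * q \<le> N" and "0 \<le> g * N"
    using p_pos n_ge by (simp_all add: g_def N_def q_def)
  then have qN: "N \<le> q * N" and "N > 0"
    by (simp_all add: mult_le_cancel_right1)
  \<comment> \<open>The worst case is \<open>u = n + 1\<close>; products with \<open>N\<close> are
    kept as atoms for linear arithmetic.\<close>
  have qu: "(q - 1) * u \<le> q * N - N + q - 1"
    using mult_left_mono[OF u(2), of "q - 1"] q by (simp add: N_def algebra_simps)
  have pu: "int p * u = (q - 1) * u + u" by (simp add: q_def algebra_simps)
  have x_lower: "x (2 * j) = g * N + 2 * (int j * N) + N - int (\<rho> (2 * j))" "int (\<rho> (2 * j)) < N"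
    if "j < p" for j
    using entry_lower_even[OF \<rho>[of "2 * j"] that] \<rho>[of "2 * j"] that
    by (simp_all add: x_def g_def N_def algebra_simps)
  have x_middle: "g * N + 2 * (q * N) + N + 1 \<le> x (2 * p)" "x (2 * p) \<le> g * N + 2 * (q * N) + 2 * N"
  proof -
    have "\<rho> (2 * p) < n" using p_pos by (intro \<rho>) simp
    then show "g * N + 2 * (q * N) + N + 1 \<le> x (2 * p)" "x (2 * p) \<le> g * N + 2 * (q * N) + 2 * N"
      using entry_middle[of "\<rho> (2 * p)"] twist_less[of "\<rho> (2 * p)"]
      by (simp_all add: x_def g_def N_def q_def algebra_simps)
  qed
  have x_upper: "g * N + 2 * (q * N) + 3 * N + 2 * (int k * N) + 1 \<le> x (2 * p + 1 + 2 * k)"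
    "x (2 * p + 1 + 2 * k) \<le> g * N + 2 * (q * N) + 4 * N + 2 * (int k * N)" if "k < p - 1" for k
  proof -
    have "\<rho> (2 * p + 1 + 2 * k) < n" using that by (intro \<rho>) simp
    then show "g * N + 2 * (q * N) + 3 * N + 2 * (int k * N) + 1 \<le> x (2 * p + 1 + 2 * k)"
      "x (2 * p + 1 + 2 * k) \<le> g * N + 2 * (q * N) + 4 * N + 2 * (int k * N)"
      using entry_upper_odd[of "\<rho> (2 * p + 1 + 2 * k)", OF _ that]
      by (simp_all add: x_def g_def N_def q_def algebra_simps)
  qed
  have "sum_list (map x [0..<4 * p]) = 0 \<and> simple_modulo m (map x [0..<4 * p])"
  proof (rule simple_modulo_paired[of p u x m])
    show "0 < p" "0 < u" by (fact p_pos u)+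
    show "x (2 * j) + x (2 * j + 1) = - u" if "j < p" for j
      using lower[OF that] by (simp add: x_def)
    show "x (2 * p + 1 + 2 * k) + x (2 * p + 2 + 2 * k) = u" if "k < p - 1" for k
      using upper[OF that] by (simp add: x_def)
    show "x (2 * p) + x (4 * p - 1) = u"
      using middle by (simp add: x_def)
    show "x (2 * j) + u < x (2 * Suc j)" if "Suc j < p" for j
    proof -
      have "int (Suc j) * N = int j * N + N" by (simp add: algebra_simps)
      then show ?thesis
        using x_lower(1)[of j] x_lower(1)[OF that] lower_step[OF that] that unfolding N_def by linarith
    qed
    show "x (2 * p + 1 + 2 * k) < x (2 * p + 1 + 2 * Suc k)" if "Suc k < p - 1" for k
    proof -
      have "int (Suc k) * N = int k * N + N" by (simp add: algebra_simps)
      then show ?thesis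
        using x_upper(2)[of k] x_upper(1)[OF that] that \<open>N > 0\<close> by linarith
    qed
    show "0 < x 0"
      using x_lower[of 0] p_pos \<open>0 \<le> g * N\<close> by simp
    show "x (2 * (p - 1)) + u < x (2 * p)"
    proof -
      have "int (p - 1) * N = q * N - N"
        using p_pos by (simp add: q_def of_nat_diff algebra_simps)
      then show ?thesis
        using x_lower[of "p - 1"] x_middle p_pos u \<open>N > 0\<close> unfolding N_def by linarith
    qed
    show "x (2 * p) + int p * u < m + u"
      using x_middle(2) qu pu q qN N \<open>0 \<le> g * N\<close> unfolding m by linarith
    fix k assume k: "k < p - 1"
    \<comment> \<open>This bounds \<open>2 * (int k * N)\<close> by
      \<open>2 * (q * N) - 4 * N\<close>, which makes room for the sum of two large entries in the
      last goal; these already consume both copies of \<open>g * N\<close> in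
      \<open>m\<close>.\<close>
    have "int k + 2 \<le> q" using k by (simp add: q_def)
    then have kN: "int k * N + 2 * N \<le> q * N" "0 \<le> int k * N"
      using mult_right_mono[of "int k + 2" q N] \<open>N > 0\<close> by (simp_all add: algebra_simps)
    have "(q - 1) * u < x (2 * p + 1 + 2 * k)"
      using x_upper(1)[OF k] kN qu q qN N \<open>0 \<le> g * N\<close> by linarith
    moreover have "int (p - 1) = q - 1"
      using p_pos by (simp add: q_def of_nat_diff)
    ultimately show "int (p - 1) * u < x (2 * p + 1 + 2 * k)"
      by simp
    show "x (2 * p) + x (2 * p + 1 + 2 * k) + int p * u < m + 2 * u"
      using x_upper(2)[OF k] x_middle(2) kN qu pu q qN N \<open>0 \<le> g * N\<close> u(1) unfolding m by linarith
  qed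
  then show ?thesis by (simp only: x_def[abs_def] m_def)
qed

lemma simple_modulo_row:
  assumes "r < n"
  shows "sum_list (map (\<lambda>i. entry i r) [0..<4 * p]) = 0
    \<and> simple_modulo (int (2 * (4 * p + \<gamma>) * n + 1)) (map (\<lambda>i. entry i r) [0..<4 * p])"
proof -
  \<comment> \<open>This is \<open>n + r\<close> minus the cyclic predecessor of \<open>r\<close>,
    which is \<open>n - 1\<close> in row \<open>0\<close>. The twisted pair gives the same value
    because \<open>twist\<close> wraps exactly there too.\<close>
  define u where "u = (if r = 0 then 1 else int n + 1)"
  have pred: "int ((r + n - 1) mod n) = (if r = 0 then int n - 1 else int r - 1)"
  proof (cases "r = 0")
    case False
    then have "r + n - 1 = (r - 1) + n" by simp
    then have "(r + n - 1) mod n = r - 1"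
      using assms by (simp only: mod_add_self2) simp
    then show ?thesis using False by (simp add: of_nat_diff)
  qed (use n_pos in \<open>simp add: of_nat_diff\<close>)
  have twist: "int (twist r) - int (twist ((r + n - \<alpha>) mod n)) = (if r = 0 then 1 - int n else 1)"
    using twist_0 twist_shift_0 twist_shift_pos[of r] assms n_pos by (auto simp: of_nat_diff)
  show ?thesis
  proof (rule simple_modulo_entries[of "\<lambda>_. r" u])
    show "entry (2 * j) r + entry (2 * j + 1) r = - u" if "j < p" for j
      unfolding entry_lower_even[OF assms that] entry_lower_odd[OF assms that] pred
      by (simp add: u_def algebra_simps)
    show "entry (2 * p + 1 + 2 * k) r + entry (2 * p + 2 + 2 * k) r = u" if "k < p - 1" for k
      unfolding entry_upper_even[OF assms that] entry_upper_odd[OF assms that] pred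
      by (simp add: u_def algebra_simps)
    show "entry (2 * p) r + entry (4 * p - 1) r = u"
      using twist unfolding entry_middle[OF assms] entry_last[OF assms]
      by (simp add: u_def algebra_simps split: if_splits)
  qed (use assms n_gt_1 in \<open>auto simp: u_def\<close>)
qed

text \<open>In a column, consecutive diagonals lie one row apart and the diagonals
  \<open>2 * p\<close> and \<open>2 * p + \<alpha>\<close> lie \<open>\<alpha>\<close> rows apart,
  cyclically. So the offsets within a pair cancel and the difference of adjacent blocks remains,
  \<open>n\<close> up to sign.\<close>

lemma simple_modulo_col:
  "sum_list (map (\<lambda>i. entry i ((c + diag i) mod n)) [0..<4 * p]) = 0
    \<and> simple_modulo (int (2 * (4 * p + \<gamma>) * n + 1))
      (map (\<lambda>i. entry i ((c + diag i) mod n)) [0..<4 * p])"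
proof -
  let ?\<rho> = "\<lambda>i. (c + diag i) mod n"
  have \<rho>_less: "?\<rho> i < n" for i using n_pos by simp
  have \<rho>_Suc: "(?\<rho> (Suc i) + n - 1) mod n = ?\<rho> i" if "Suc i < 4 * p - 1" for i
    using that n_pos mod_shift_back[of 1 n "c + i"] by (simp add: diag_def)
  have \<rho>_last: "(?\<rho> (4 * p - 1) + n - \<alpha>) mod n = ?\<rho> (2 * p)"
  proof -
    have "2 * p \<noteq> 4 * p - 1" using p_pos by presburger
    then show ?thesis
      using \<alpha>_less mod_shift_back[of \<alpha> n "c + 2 * p"] by (simp add: diag_def add.assoc)
  qed
  show ?thesis
  proof (rule simple_modulo_entries[of ?\<rho> "int n"])
    show "entry (2 * j) (?\<rho> (2 * j)) + entry (2 * j + 1) (?\<rho> (2 * j + 1)) = - int n" if "j < p" for j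
    proof -
      have "(?\<rho> (2 * j + 1) + n - 1) mod n = ?\<rho> (2 * j)"
        using \<rho>_Suc[of "2 * j"] that by simp
      then show ?thesis
        unfolding entry_lower_even[OF \<rho>_less that] entry_lower_odd[OF \<rho>_less that]
        by (simp add: algebra_simps)
    qed
    show "entry (2 * p + 1 + 2 * k) (?\<rho> (2 * p + 1 + 2 * k))
      + entry (2 * p + 2 + 2 * k) (?\<rho> (2 * p + 2 + 2 * k)) = int n" if "k < p - 1" for k
    proof -
      have "(?\<rho> (2 * p + 2 + 2 * k) + n - 1) mod n = ?\<rho> (2 * p + 1 + 2 * k)"
        using \<rho>_Suc[of "2 * p + 1 + 2 * k"] that by simp
      then show ?thesis
        unfolding entry_upper_even[OF \<rho>_less that] entry_upper_odd[OF \<rho>_less that]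
        by (simp add: algebra_simps)
    qed
    show "entry (2 * p) (?\<rho> (2 * p)) + entry (4 * p - 1) (?\<rho> (4 * p - 1)) = int n"
      unfolding entry_middle[OF \<rho>_less] entry_last[OF \<rho>_less] \<rho>_last by (simp add: algebra_simps)
    show "int n < 2 * int n + int (?\<rho> (2 * j)) - int (?\<rho> (2 * Suc j))" for j
      using \<rho>_less[of "2 * Suc j"] by linarith
  qed (use n_pos in simp_all)
qed

section \<open>Assembling the Heffter array\<close>

lemma row_properties:
  assumes "r < n"
  shows "length (row_entries n array r) = 4 * p" "sum_list (row_entries n array r) = 0"
    "simple_modulo (int (2 * (4 * p + \<gamma>) * n + 1)) (row_entries n array r)"
proof -
  let ?xs = "map (\<lambda>i. entry i r) [0..<4 * p]"
  have "sum_list (rev ?xs) = 0"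
    using simple_modulo_row[OF assms] by (simp only: sum_list_rev)
  moreover have "simple_modulo (int (2 * (4 * p + \<gamma>) * n + 1)) (rev ?xs)"
    using simple_modulo_row[OF assms] by (blast intro: simple_modulo_rev)
  moreover have "length (rev ?xs) = 4 * p" by simp
  moreover obtain k where "row_entries n array r = rotate k (rev ?xs)"
    using row_entries_array[OF assms] by blast
  ultimately show "length (row_entries n array r) = 4 * p" "sum_list (row_entries n array r) = 0"
    "simple_modulo (int (2 * (4 * p + \<gamma>) * n + 1)) (row_entries n array r)"
    by (simp_all only: length_rotate sum_list_rotate simple_modulo_rotate)
qed

lemma col_properties:
  assumes "c < n"
  shows "length (col_entries n array c) = 4 * p" "sum_list (col_entries n array c) = 0"
    "simple_modulo (int (2 * (4 * p + \<gamma>) * n + 1)) (col_entries n array c)"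
proof -
  let ?xs = "map (\<lambda>i. entry i ((c + diag i) mod n)) [0..<4 * p]"
  have "length ?xs = 4 * p" by simp
  moreover obtain k where "col_entries n array c = rotate k ?xs"
    using col_entries_array[OF assms] by blast
  ultimately show "length (col_entries n array c) = 4 * p" "sum_list (col_entries n array c) = 0"
    "simple_modulo (int (2 * (4 * p + \<gamma>) * n + 1)) (col_entries n array c)"
    using simple_modulo_col[of c] by (simp_all only: length_rotate sum_list_rotate simple_modulo_rotate)
qed

end

theorem theorem3p1:
  fixes p n \<gamma> \<alpha> :: nat
  assumes "p > 0" and "n \<ge> 4 * p" and "\<gamma> > 0"
    and "2 * p - 1 \<le> \<alpha>" and "\<alpha> \<le> n - 1 - 2 * p" and "gcd n \<alpha> = 1"
  shows "\<exists>A. support_shifted_heffter n (4 * p) \<gamma> A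
           \<and> globally_simple n (4 * p) \<gamma> A
           \<and> filled_cells n A = (\<Union>d \<in> {0..4 * p - 2} \<union> {2 * p + \<alpha>}. diagonal n d)"
proof -
  have \<alpha>: "\<alpha> \<noteq> 0" using assms(1,4) by simp
  have "gcd \<alpha> n = 1" using assms(6) by (simp add: gcd.commute)
  \<comment> \<open>Bezout provides the inverse of \<open>\<alpha>\<close>; \<open>1 < n\<close>
    ensures that \<open>n * y + 1\<close> has residue \<open>1\<close> and not
    \<open>0\<close>.\<close>
  then obtain \<beta> y where "\<alpha> * \<beta> = n * y + 1"
    using bezout_nat[OF \<alpha>, of n] by auto
  moreover have "1 < n" using assms(1,2) by simp
  ultimately have "(\<beta> * \<alpha>) mod n = 1"
    by (simp add: mult.commute[of \<beta>] mod_Suc)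
  then interpret heffter_construction p n \<gamma> \<alpha> \<beta>
    using assms by unfold_locales linarith+
  have "support_shifted_heffter n (4 * p) \<gamma> array"
    unfolding support_shifted_heffter_def using row_properties col_properties array_support_array by blast
  moreover have "globally_simple n (4 * p) \<gamma> array"
    unfolding globally_simple_def using row_properties col_properties by blast
  ultimately show ?thesis
    using filled_cells_array by blast
qed

end
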